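(* Let $f\in C[0,\pi]$. Then \[ \lim_{n\to\infty}\|\mathcal{D}_n(f)-f\|_\infty=0, \] where $\mathcal{D}_n$ is the $n$-th Gr\"unwald--Durrmeyer operator and $\|\cdot\|_\infty$ is the supremum norm on $[0,\pi]$.
   Context: For $n=1,2,\dots$ and $k=1,\dots,n$ let $\theta_k^{(n)}=\frac{2k-1}{2n}\pi$ and \[ P_k(t)=(-1)^{k+1}\frac{\cos(nt)\,\sin\theta_k^{(n)}}{n\,(\cos t-\cos\theta_k^{(n)})},\qquad t\in\mathbb{R}, \] where the (removable) singularities are filled in by continuity ($P_k$ depends on $n$ as well). Put \[ S_{k,n}(t)=\tfrac12\left(P_k\!\left(t-\tfrac{\pi}{2n}\right)+P_k\!\left(t+\tfrac{\pi}{2n}\right)\right). \] The $n$-th Gr\"unwald--Durrmeyer operator is defined, for $f\in L^p[0,\pi]$ ($1\le p\le+\infty$, Lebesgue measure) and $\theta\in[0,\pi]$, by \[ \mathcal{D}_n(f)(\theta)=\frac{n}{\pi}\sum_{k=1}^n S_{k,n}(\theta)\int_0^\pi f(t)\,S_{k,n}(t)\,dt . \] *)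

theory Defs
  imports "HOL-Analysis.Analysis"
begin

definition cheb_node :: "nat \<Rightarrow> nat \<Rightarrow> real" where
  "cheb_node n k = (2 * real k - 1) / (2 * real n) * pi"

definition grunwald_quot :: "nat \<Rightarrow> nat \<Rightarrow> real \<Rightarrow> real" where
  "grunwald_quot n k t =
     (-1) ^ (k + 1) * (cos (real n * t) * sin (cheb_node n k))
       / (real n * (cos t - cos (cheb_node n k)))"

text \<open>At a zero of the denominator of \<open>grunwald_quot\<close> the value is the limit of
  \<open>grunwald_quot\<close> there; for \<open>1 \<le> k \<le> n\<close> this limit exists, since
  \<open>cos (n * t)\<close> vanishes at these points and \<open>sin (cheb_node n k)\<close> is nonzero.\<close>

definition grunwald_P :: "nat \<Rightarrow> nat \<Rightarrow> real \<Rightarrow> real" where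
  "grunwald_P n k t =
     (if cos t = cos (cheb_node n k) then Lim (at t) (grunwald_quot n k) else grunwald_quot n k t)"

definition grunwald_S :: "nat \<Rightarrow> nat \<Rightarrow> real \<Rightarrow> real" where
  "grunwald_S n k t = (grunwald_P n k (t - pi / (2 * real n)) + grunwald_P n k (t + pi / (2 * real n))) / 2"

definition Grunwald_Durrmeyer :: "nat \<Rightarrow> (real \<Rightarrow> real) \<Rightarrow> real \<Rightarrow> real" where
  "Grunwald_Durrmeyer n f \<theta> =
     real n / pi * (\<Sum>k=1..n. grunwald_S n k \<theta> * (LINT t:{0..pi}|lebesgue. f t * grunwald_S n k t))"

text \<open>The supremum is taken in \<open>real\<close>, so \<open>sup_norm\<close> is meaningful only for functions
  bounded on \<open>{0..pi}\<close>, in particular for continuous ones.\<close>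

definition sup_norm :: "(real \<Rightarrow> real) \<Rightarrow> real" where
  "sup_norm g = (SUP \<theta>\<in>{0..pi}. \<bar>g \<theta>\<bar>)"

end

theory Submission
  imports Defs "HOL-Real_Asymp.Real_Asymp"
begin

text \<open>By Christoffel--Darboux, each \<open>P\<^sub>k\<close> is a cosine polynomial of degree less than \<open>n\<close>, and the
  discrete orthogonality of the cosines at the Chebyshev nodes turns the operator into a multiplier on
  cosine series: the coefficient of \<open>cos (j \<theta>)\<close> is multiplied by \<open>cos\<^sup>2 (j \<pi> / (2 n))\<close> for \<open>j < n\<close>
  and by \<open>0\<close> otherwise. The multipliers have second differences of order \<open>1 / n\<^sup>2\<close>, so two summations by
  parts write the operator as a combination of Fejer means whose coefficients have bounded total
  size. As Fejer means are contractions, the operators are uniformly bounded; they converge on each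
  \<open>cos (i \<theta>)\<close>, and polynomials in \<open>cos \<theta>\<close> are dense in the continuous functions.\<close>

section \<open>Cosine expansions of the kernels\<close>

text \<open>These are the normalising weights of the cosine system: the squared norm of
  \<open>cos (real j * t)\<close> is \<open>pi / cosw j\<close> on \<open>{0..pi}\<close> and, for
  \<open>j < n\<close>, \<open>n / cosw j\<close> on the \<open>n\<close> Chebyshev nodes.\<close>

definition cosw :: "nat \<Rightarrow> real" where
  "cosw j = (if j = 0 then 1 else 2)"

text \<open>Induction through the three-term recurrence of the cosines. When \<open>s\<close> is a
  zero of \<open>cos (real (Suc n) * s)\<close>, the second product on the right vanishes and the
  quotient defining \<open>grunwald_P\<close> appears.\<close>

lemma Christoffel_Darboux_cos:
  "(cos t - cos s) * (\<Sum>j<Suc n. cosw j * cos (real j * s) * cos (real j * t)) =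
     cos (real (Suc n) * t) * cos (real n * s) - cos (real n * t) * cos (real (Suc n) * s)"
proof (induction n)
  case 0
  then show ?case by (simp add: cosw_def)
next
  case (Suc n)
  have rec: "cos (real (Suc (Suc n)) * x) = 2 * cos x * cos (real (Suc n) * x) - cos (real n * x)" for x
  proof -
    have "cos (real (Suc (Suc n)) * x) = cos (real (Suc n) * x + x)"
      "cos (real n * x) = cos (real (Suc n) * x - x)"
      by (simp_all add: algebra_simps)
    then show ?thesis by (simp add: cos_add cos_diff)
  qed
  have "(cos t - cos s) * (\<Sum>j<Suc (Suc n). cosw j * cos (real j * s) * cos (real j * t)) =
      cos (real (Suc n) * t) * cos (real n * s) - cos (real n * t) * cos (real (Suc n) * s)
      + (cos t - cos s) * (2 * cos (real (Suc n) * s) * cos (real (Suc n) * t))"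
    unfolding sum.lessThan_Suc[of _ "Suc n"] distrib_left Suc.IH by (simp add: cosw_def)
  also have "\<dots> = cos (real (Suc (Suc n)) * t) * cos (real (Suc n) * s)
      - cos (real (Suc n) * t) * cos (real (Suc (Suc n)) * s)"
    unfolding rec by (simp add: algebra_simps del: of_nat_Suc)
  finally show ?case .
qed

lemma cheb_node_bounds:
  assumes "k \<in> {1..n}"
  shows "0 < cheb_node n k" "cheb_node n k < pi"
proof -
  have "cheb_node n k < 1 * pi" "0 < cheb_node n k"
    unfolding cheb_node_def using assms
    by (intro mult_strict_right_mono mult_pos_pos; auto)+
  then show "0 < cheb_node n k" "cheb_node n k < pi" by simp_all
qed

lemma cos_sin_cheb_node:
  assumes "k \<in> {1..n}"
  shows "cos (real n * cheb_node n k) = 0" "sin (real n * cheb_node n k) = (-1) ^ (k + 1)"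
proof -
  obtain m where m: "k = Suc m" using assms by (cases k) auto
  have "real n * cheb_node n k = real m * pi + pi / 2"
    using assms by (simp add: cheb_node_def m field_simps)
  then show "cos (real n * cheb_node n k) = 0" "sin (real n * cheb_node n k) = (-1) ^ (k + 1)"
    by (simp_all add: cos_add sin_add m)
qed

text \<open>The difference quotient of the cosine tends to \<open>- sin t\<close>, so it is nonzero
  near \<open>t\<close>. Hence the singularities of \<open>grunwald_quot\<close> are
  isolated.\<close>

lemma eventually_cos_neq:
  assumes "sin t \<noteq> (0::real)"
  shows "eventually (\<lambda>x. cos x \<noteq> cos t) (at t)"
proof -
  have "((\<lambda>x. (cos x - cos t) / (x - t)) \<longlongrightarrow> - sin t) (at t)"
    using DERIV_cos[of t] by (simp add: has_field_derivative_iff)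
  then have "eventually (\<lambda>x. (cos x - cos t) / (x - t) \<noteq> 0) (at t)"
    by (rule tendsto_imp_eventually_ne) (use assms in simp)
  then show ?thesis by eventually_elim auto
qed

text \<open>Away from the singularities this is Christoffel--Darboux with \<open>s\<close> the node.
  At a singularity the continuous right-hand side supplies the limit.\<close>

lemma grunwald_P_eq:
  assumes k: "k \<in> {1..n}"
  shows "grunwald_P n k t =
    (\<Sum>j<n. cosw j * cos (real j * cheb_node n k) * cos (real j * t)) / real n"
proof -
  define s where "s = cheb_node n k"
  define Q where "Q x = (\<Sum>j<n. cosw j * cos (real j * s) * cos (real j * x)) / real n" for x
  obtain m where m: "n = Suc m" using k by (cases n) auto
  have "cos (real m * s) = cos (real n * s - s)"
    by (simp add: m algebra_simps)
  \<comment> \<open>Since \<open>cos (real n * s) = 0\<close>, only the product of sines survives;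
    \<open>sin (real n * s)\<close> is the sign in \<open>grunwald_quot\<close>.\<close>
  then have cm: "cos (real m * s) = (-1) ^ (k + 1) * sin s"
    using cos_sin_cheb_node[OF k] by (simp add: cos_diff s_def)
  have "(cos x - cos s) * (real n * Q x) = (-1) ^ (k + 1) * (cos (real n * x) * sin s)" for x
    using Christoffel_Darboux_cos[of x s m] cos_sin_cheb_node(1)[OF k]
    unfolding Q_def m[symmetric] cm s_def[symmetric]
    using k by simp
  then have eq: "grunwald_quot n k x = Q x" if "cos x \<noteq> cos s" for x
    using that k unfolding grunwald_quot_def s_def[symmetric]
    by (simp add: field_simps)
  show ?thesis
  proof (cases "cos t = cos s")
    case False
    then show ?thesis using eq[of t] by (simp add: grunwald_P_def Q_def s_def)
  next
    case True
    have "sin s > 0" using cheb_node_bounds[OF k] by (simp add: s_def sin_gt_zero)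
    \<comment> \<open>The point \<open>t\<close> may differ from \<open>s\<close>, but equal cosines
      force equal squares of the sines.\<close>
    then have "sin t \<noteq> 0"
      using sin_squared_eq[of t] sin_squared_eq[of s] True by force
    then have ev: "eventually (\<lambda>x. grunwald_quot n k x = Q x) (at t)"
      using eventually_cos_neq[of t] True eq by (auto elim: eventually_mono)
    have "(Q \<longlongrightarrow> Q t) (at t)"
      unfolding Q_def using k by (intro tendsto_intros) auto
    then have "(grunwald_quot n k \<longlongrightarrow> Q t) (at t)"
      using tendsto_cong[OF ev] by blast
    then have "Lim (at t) (grunwald_quot n k) = Q t"
      by (intro tendsto_Lim) auto
    then show ?thesis using True by (simp add: grunwald_P_def Q_def s_def)
  qed
qed

text \<open>Averaging the shifts by \<open>h\<close> and \<open>-h\<close> multiplies the frequency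
  \<open>j\<close> by \<open>cos (real j * h)\<close>.\<close>

lemma grunwald_S_eq:
  assumes "k \<in> {1..n}"
  shows "grunwald_S n k t =
    (\<Sum>j<n. cosw j * cos (real j * (pi / (2 * real n))) * cos (real j * cheb_node n k) * cos (real j * t)) / real n"
proof -
  define h where "h = pi / (2 * real n)"
  have "grunwald_S n k t = (\<Sum>j<n. cosw j * cos (real j * cheb_node n k) *
      ((cos (real j * (t - h)) + cos (real j * (t + h))) / 2)) / real n"
    unfolding grunwald_S_def grunwald_P_eq[OF assms] h_def[symmetric]
    by (simp add: sum_divide_distrib sum.distrib[symmetric] field_simps)
  also have "\<dots> = (\<Sum>j<n. cosw j * cos (real j * h) * cos (real j * cheb_node n k) * cos (real j * t)) / real n"
    by (intro arg_cong2[of _ _ _ _ "(/)"] sum.cong) (simp_all add: cos_add cos_diff ring_distribs)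
  finally show ?thesis unfolding h_def .
qed

section \<open>Discrete orthogonality and the multiplier form of the operator\<close>

text \<open>The angles are odd multiples of \<open>x = m pi / (2 n)\<close>, so multiplication by
  \<open>2 * sin x\<close> telescopes the sum to \<open>sin (m pi) = 0\<close>. The range of
  \<open>m\<close> puts \<open>x\<close> strictly between \<open>0\<close> and \<open>pi\<close>,
  where the sine is nonzero.\<close>

lemma sum_cos_cheb_node:
  assumes "0 < m" "m < 2 * n"
  shows "(\<Sum>k=1..n. cos (real m * cheb_node n k)) = 0"
proof -
  define x where "x = real m * pi / (2 * real n)"
  have n: "n > 0" using assms by auto
  have "real m * pi < 2 * real n * pi"
    using assms by (intro mult_strict_right_mono) (auto simp flip: of_nat_mult)
  then have "0 < x" "x < pi"
    using assms n by (simp_all add: x_def field_simps)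
  then have "sin x > 0" by (rule sin_gt_zero)
  have node: "real m * cheb_node n k = (2 * real k - 1) * x" for k
    by (simp add: x_def cheb_node_def)
  have "2 * sin x * (\<Sum>k=1..N. cos ((2 * real k - 1) * x)) = sin (2 * real N * x)" for N
  proof (induction N)
    case (Suc N)
    have "sin (2 * real (Suc N) * x) = sin ((2 * real (Suc N) - 1) * x + x)"
      "sin (2 * real N * x) = sin ((2 * real (Suc N) - 1) * x - x)"
      by (simp_all add: algebra_simps)
    then show ?case using Suc by (simp add: sin_add sin_diff distrib_left del: of_nat_Suc)
  qed simp
  moreover have "sin (2 * real n * x) = 0"
    using n by (simp add: x_def)
  ultimately have "2 * sin x * (\<Sum>k=1..n. cos ((2 * real k - 1) * x)) = 0"
    by simp
  then show ?thesis using \<open>sin x > 0\<close> unfolding node by simp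
qed

text \<open>Product-to-sum reduces this to the frequencies \<open>i - j\<close> and
  \<open>i + j\<close>, both below \<open>2 * n\<close>; a sum survives only at frequency
  \<open>0\<close>.\<close>

lemma cheb_node_orthogonal:
  assumes "i < n" "j < n"
  shows "(\<Sum>k=1..n. cos (real i * cheb_node n k) * cos (real j * cheb_node n k)) =
    (if i = j then real n / cosw j else 0)"
proof -
  \<comment> \<open>By symmetry \<open>b \<le> a\<close> suffices, which makes \<open>a - b\<close>
    a genuine difference of naturals.\<close>
  have main: "(\<Sum>k=1..n. cos (real a * cheb_node n k) * cos (real b * cheb_node n k)) =
    (if a = b then real n / cosw b else 0)" if "a < n" "b \<le> a" for a b
  proof -
    have "(\<Sum>k=1..n. cos (real a * cheb_node n k) * cos (real b * cheb_node n k)) =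
      ((\<Sum>k=1..n. cos (real (a - b) * cheb_node n k)) + (\<Sum>k=1..n. cos (real (a + b) * cheb_node n k))) / 2"
      using \<open>b \<le> a\<close>
      by (simp add: cos_times_cos sum.distrib[symmetric] sum_divide_distrib of_nat_diff algebra_simps)
    then show ?thesis
      using that sum_cos_cheb_node[of "a - b" n] sum_cos_cheb_node[of "a + b" n]
      by (cases "a = b"; cases "b = 0") (auto simp: cosw_def)
  qed
  show ?thesis
    using main[of i j] main[of j i] assms by (cases "j \<le> i") (auto simp: mult.commute)
qed

text \<open>Each of the two factors \<open>grunwald_S\<close>, outside and inside the integral,
  contributes one cosine to the squared multiplier; summing over the nodes removes all mixed
  frequencies.\<close>

lemma Grunwald_Durrmeyer_eq:
  assumes f: "continuous_on {0..pi} f"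
  shows "Grunwald_Durrmeyer n f \<theta> =
    (\<Sum>j<n. (cos (real j * (pi / (2 * real n))))\<^sup>2 *
       (cosw j * cos (real j * \<theta>) * integral {0..pi} (\<lambda>t. f t * cos (real j * t)) / pi))"
proof (cases "n = 0")
  case True
  then show ?thesis by (simp add: Grunwald_Durrmeyer_def)
next
  case False
  define A where "A j = integral {0..pi} (\<lambda>t. f t * cos (real j * t))" for j
  define d where "d j = cosw j * cos (real j * (pi / (2 * real n)))" for j
  define u where "u k j = cos (real j * cheb_node n k)" for k j
  have S: "grunwald_S n k t = (\<Sum>j<n. d j * u k j * cos (real j * t)) / real n"
    if "k \<in> {1..n}" for k t
    using grunwald_S_eq[OF that] by (simp add: d_def u_def)
  have I: "(LINT t:{0..pi}|lebesgue. f t * grunwald_S n k t) = (\<Sum>j<n. d j * u k j * A j) / real n"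
    if k: "k \<in> {1..n}" for k
  proof -
    have "(\<lambda>t. f t * grunwald_S n k t) absolutely_integrable_on {0..pi}"
      unfolding S[OF k] using False
      by (intro absolutely_integrable_continuous_real continuous_intros f) auto
    then have "(LINT t:{0..pi}|lebesgue. f t * grunwald_S n k t) = integral {0..pi} (\<lambda>t. f t * grunwald_S n k t)"
      by (rule set_lebesgue_integral_eq_integral)
    also have "\<dots> = integral {0..pi} (\<lambda>t. \<Sum>j<n. d j * u k j / real n * (f t * cos (real j * t)))"
      unfolding S[OF k] by (simp add: sum_distrib_left sum_divide_distrib mult_ac)
    also have "\<dots> = (\<Sum>j<n. d j * u k j / real n * A j)"
      unfolding A_def
      by (subst integral_sum)
        (auto intro!: integrable_continuous_real continuous_intros f simp: integral_mult_right)
    finally show ?thesis by (simp add: sum_divide_distrib)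
  qed
  have "Grunwald_Durrmeyer n f \<theta> =
      real n / pi * (\<Sum>k=1..n. (\<Sum>i<n. d i * u k i * cos (real i * \<theta>)) / real n * ((\<Sum>j<n. d j * u k j * A j) / real n))"
    unfolding Grunwald_Durrmeyer_def by (intro arg_cong2[of _ _ _ _ "(*)"] sum.cong refl S I)
  also have "\<dots> = (\<Sum>k=1..n. (\<Sum>i<n. d i * u k i * cos (real i * \<theta>)) * (\<Sum>j<n. d j * u k j * A j)) / (real n * pi)"
    using False by (simp add: sum_distrib_left sum_divide_distrib field_simps)
  also have "(\<Sum>k=1..n. (\<Sum>i<n. d i * u k i * cos (real i * \<theta>)) * (\<Sum>j<n. d j * u k j * A j)) =
      (\<Sum>k=1..n. \<Sum>i<n. \<Sum>j<n. d i * d j * cos (real i * \<theta>) * A j * (u k i * u k j))"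
    unfolding sum_product by (intro sum.cong refl) (simp only: mult_ac)
  \<comment> \<open>The sum over the nodes moves innermost, ready for
    \<open>cheb_node_orthogonal\<close>.\<close>
  also have "\<dots> = (\<Sum>i<n. \<Sum>j<n. \<Sum>k=1..n. d i * d j * cos (real i * \<theta>) * A j * (u k i * u k j))"
    by (subst sum.swap, subst sum.swap[of _ "{..<n}" "{1..n}"]) simp
  also have "\<dots> = (\<Sum>i<n. \<Sum>j<n. if i = j then d i * d j * cos (real i * \<theta>) * A j * (real n / cosw j) else 0)"
    unfolding sum_distrib_left[symmetric] u_def
    by (intro sum.cong refl) (simp only: cheb_node_orthogonal lessThan_iff mult_zero_right split: if_split, simp)
  also have "\<dots> = (\<Sum>i<n. d i * d i * cos (real i * \<theta>) * A i * (real n / cosw i))"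
    by (intro sum.cong refl) (simp add: sum.delta)
  also have "\<dots> / (real n * pi) = (\<Sum>i<n. (d i * d i / cosw i) * cos (real i * \<theta>) * A i / pi)"
    using False by (simp add: sum_divide_distrib field_simps)
  \<comment> \<open>Both factors \<open>d\<close> carry a weight \<open>cosw\<close>, and
    orthogonality has divided one of them out.\<close>
  also have "\<dots> = (\<Sum>j<n. (cos (real j * (pi / (2 * real n))))\<^sup>2 * (cosw j * cos (real j * \<theta>) * A j / pi))"
    by (intro sum.cong refl) (simp add: d_def cosw_def power2_eq_square)
  finally show ?thesis unfolding A_def .
qed

section \<open>Fejer means\<close>

text \<open>Multiplied by \<open>1 - cos u\<close>, the inner sums telescope and the double sum becomes \<open>1 - cos (m u)\<close>.\<close>

lemma sum_cos_Fejer_nonneg: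
  "0 \<le> (\<Sum>i<m. \<Sum>j<Suc i. cosw j * cos (real j * u))"
proof (cases "cos u = 1")
  case True
  then obtain z :: int where "u = of_int z * 2 * pi" by (auto simp: cos_one_2pi_int)
  then have "real j * u = 2 * pi * of_int (int j * z)" for j by simp
  then have "cos (real j * u) = 1" for j by (metis cos_int_2pin)
  then show ?thesis by (intro sum_nonneg) (simp add: cosw_def)
next
  case False
  then have pos: "1 - cos u > 0" using cos_le_one[of u] by linarith
  have "(1 - cos u) * (\<Sum>i<m. \<Sum>j<Suc i. cosw j * cos (real j * u)) = 1 - cos (real m * u)"
  proof (induction m)
    case (Suc m)
    have "(1 - cos u) * (\<Sum>j<Suc m. cosw j * cos (real j * u)) = cos (real m * u) - cos (real (Suc m) * u)"
      using Christoffel_Darboux_cos[of 0 u m] by (simp del: of_nat_Suc sum.lessThan_Suc)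
    then show ?case using Suc
      unfolding sum.lessThan_Suc[of _ m] distrib_left by simp
  qed simp
  then have "0 \<le> (1 - cos u) * (\<Sum>i<m. \<Sum>j<Suc i. cosw j * cos (real j * u))"
    by (simp only: diff_ge_0_iff_ge cos_le_one)
  then show ?thesis using pos by (simp only: zero_le_mult_iff) linarith
qed

lemma integral_cos_nat:
  "integral {0..pi} (\<lambda>t. cos (real m * t)) = (if m = 0 then pi else 0)"
proof (cases "m = 0")
  case False
  have "((\<lambda>t. cos (real m * t)) has_integral (sin (real m * pi) / real m - sin (real m * 0) / real m)) {0..pi}"
    using False
    by (intro fundamental_theorem_of_calculus)
      (auto intro!: derivative_eq_intros simp flip: has_real_derivative_iff_has_vector_derivative)
  then show ?thesis using False by (simp add: integral_unique)
qed simp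

lemma integral_cos_mult_cos:
  "integral {0..pi} (\<lambda>t. cos (real i * t) * cos (real j * t)) = (if i = j then pi / cosw j else 0)"
proof -
  have main: "integral {0..pi} (\<lambda>t. cos (real a * t) * cos (real b * t)) = (if a = b then pi / cosw b else 0)"
    if "b \<le> a" for a b
  proof -
    have "integral {0..pi} (\<lambda>t. cos (real a * t) * cos (real b * t)) =
      integral {0..pi} (\<lambda>t. cos (real (a - b) * t) / 2 + cos (real (a + b) * t) / 2)"
      using that by (intro integral_cong) (simp add: cos_times_cos of_nat_diff algebra_simps add_divide_distrib)
    also have "\<dots> = integral {0..pi} (\<lambda>t. cos (real (a - b) * t)) / 2 + integral {0..pi} (\<lambda>t. cos (real (a + b) * t)) / 2"
      by (subst integral_add) (auto intro!: integrable_continuous_real continuous_intros)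
    finally show ?thesis
      using that unfolding integral_cos_nat by (auto simp: cosw_def)
  qed
  show ?thesis using main[of i j] main[of j i] by (cases "j \<le> i") (auto simp: mult.commute)
qed

text \<open>The double sum integrates \<open>f\<close> against a nonnegative kernel \<open>K\<close>
  of total mass \<open>m\<close>. Divided by \<open>m\<close>, it is a Fejer mean, and the bound
  says that Fejer means are contractions.\<close>

lemma Fejer_sum_bound:
  assumes f: "continuous_on {0..pi} f" and M: "\<And>t. t \<in> {0..pi} \<Longrightarrow> \<bar>f t\<bar> \<le> M"
  shows "\<bar>\<Sum>i<m. \<Sum>j<Suc i. cosw j * cos (real j * \<theta>) * integral {0..pi} (\<lambda>t. f t * cos (real j * t)) / pi\<bar>
    \<le> real m * M"
proof -
  define K where "K t = (\<Sum>i<m. \<Sum>j<Suc i. cosw j * cos (real j * \<theta>) / pi * cos (real j * t))" for t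
  \<comment> \<open>Product-to-sum splits \<open>K\<close> into Fejer kernels at
    \<open>\<theta> - t\<close> and \<open>\<theta> + t\<close>, both nonnegative.\<close>
  have "K t = ((\<Sum>i<m. \<Sum>j<Suc i. cosw j * cos (real j * (\<theta> - t))) +
      (\<Sum>i<m. \<Sum>j<Suc i. cosw j * cos (real j * (\<theta> + t)))) / (2 * pi)" for t
    unfolding K_def sum.distrib[symmetric] sum_divide_distrib
    by (intro sum.cong refl) (simp add: cos_add cos_diff ring_distribs)
  then have K0: "K t \<ge> 0" for t
    using sum_cos_Fejer_nonneg by (simp add: add_nonneg_nonneg)
  have cK: "continuous_on {0..pi} K"
    unfolding K_def by (intro continuous_intros) auto
  have int: "integral {0..pi} (\<lambda>t. g t * K t) =
      (\<Sum>i<m. \<Sum>j<Suc i. cosw j * cos (real j * \<theta>) * integral {0..pi} (\<lambda>t. g t * cos (real j * t)) / pi)"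
    if g: "continuous_on {0..pi} g" for g
  proof -
    have "integral {0..pi} (\<lambda>t. g t * K t) =
      integral {0..pi} (\<lambda>t. \<Sum>i<m. \<Sum>j<Suc i. cosw j * cos (real j * \<theta>) / pi * (g t * cos (real j * t)))"
      unfolding K_def sum_distrib_left by (simp add: mult_ac del: sum.lessThan_Suc)
    also have "\<dots> = (\<Sum>i<m. integral {0..pi} (\<lambda>t. \<Sum>j<Suc i. cosw j * cos (real j * \<theta>) / pi * (g t * cos (real j * t))))"
      by (intro integral_sum integrable_continuous_real continuous_intros g) auto
    also have "\<dots> = (\<Sum>i<m. \<Sum>j<Suc i. integral {0..pi} (\<lambda>t. cosw j * cos (real j * \<theta>) / pi * (g t * cos (real j * t))))"
      by (intro sum.cong refl integral_sum integrable_continuous_real continuous_intros g) auto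
    finally show ?thesis by (simp del: sum.lessThan_Suc)
  qed
  \<comment> \<open>For the constant function \<open>1\<close> only \<open>j = 0\<close> survives,
    giving \<open>1\<close> for each \<open>i < m\<close>.\<close>
  have int1: "integral {0..pi} K = real m"
  proof -
    have "integral {0..pi} K = (\<Sum>i<m. \<Sum>j<Suc i. cosw j * cos (real j * \<theta>) * (if j = 0 then pi else 0) / pi)"
      using int[of "\<lambda>_. 1"] unfolding mult_1 integral_cos_nat by simp
    also have "\<dots> = (\<Sum>i<m. \<Sum>j<Suc i. if j = 0 then 1 else 0)"
      by (intro sum.cong refl) (auto simp: cosw_def)
    also have "\<dots> = real m" by (simp add: sum.delta del: sum.lessThan_Suc)
    finally show ?thesis .
  qed
  have "\<bar>integral {0..pi} (\<lambda>t. f t * K t)\<bar> \<le> integral {0..pi} (\<lambda>t. M * K t)"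
    unfolding real_norm_def[symmetric]
  proof (rule integral_norm_bound_integral)
    show "norm (f t * K t) \<le> M * K t" if "t \<in> {0..pi}" for t
      using M[OF that] K0[of t] by (simp add: abs_mult mult_right_mono)
  qed (intro integrable_continuous_real continuous_intros f cK)+
  then show ?thesis using int[OF f] int1 by (simp add: mult.commute)
qed

section \<open>Uniform boundedness of the operators\<close>

text \<open>Two Abel summations move the differences onto the multipliers \<open>c\<close>; what
  multiplies the second differences are unnormalised Fejer sums of \<open>x\<close>.\<close>

lemma summation_by_parts_twice:
  fixes c x :: "nat \<Rightarrow> real"
  shows "(\<Sum>j<n. c j * x j) =
    (\<Sum>j<n. (c j - 2 * c (Suc j) + c (Suc (Suc j))) * (\<Sum>i<Suc j. \<Sum>l<Suc i. x l))
    + (c n - c (Suc n)) * (\<Sum>i<n. \<Sum>l<Suc i. x l) + c n * (\<Sum>l<n. x l)"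
proof -
  define B where "B m = (\<Sum>l<m. x l)" for m
  define C where "C m = (\<Sum>i<m. B (Suc i))" for m
  define T where "T m = (\<Sum>j<m. (c j - 2 * c (Suc j) + c (Suc (Suc j))) * C (Suc j))" for m
  have B: "B (Suc m) = B m + x m" and C: "C (Suc m) = C m + B (Suc m)" for m
    by (simp_all add: B_def C_def)
  have T: "T (Suc m) = T m + (c m - 2 * c (Suc m) + c (Suc (Suc m))) * C (Suc m)" for m
    by (simp add: T_def)
  have "(\<Sum>j<n. c j * x j) = T n + (c n - c (Suc n)) * C n + c n * B n"
  proof (induction n)
    case 0
    then show ?case by (simp add: T_def C_def B_def)
  next
    case (Suc n)
    then show ?case by (simp add: T C B algebra_simps)
  qed
  then show ?thesis unfolding T_def C_def B_def .
qed

text \<open>There are \<open>n\<close> second differences of size at most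
  \<open>2 * h\<^sup>2\<close>, each against a Fejer sum of size at most \<open>n * M\<close>. As
  \<open>n * h = pi / 2\<close>, the total is bounded independently of \<open>n\<close>.\<close>

lemma Grunwald_Durrmeyer_bound:
  assumes f: "continuous_on {0..pi} f" and M: "\<And>t. t \<in> {0..pi} \<Longrightarrow> \<bar>f t\<bar> \<le> M" and n: "n > 0"
  shows "\<bar>Grunwald_Durrmeyer n f \<theta>\<bar> \<le> 8 * M"
proof -
  define h where "h = pi / (2 * real n)"
  define c where "c j = (cos (real j * h))\<^sup>2" for j
  define x where "x j = cosw j * cos (real j * \<theta>) * integral {0..pi} (\<lambda>t. f t * cos (real j * t)) / pi" for j
  define C where "C m = (\<Sum>i<m. \<Sum>l<Suc i. x l)" for m
  have M0: "M \<ge> 0" using M[of 0] by auto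
  have C: "\<bar>C m\<bar> \<le> real m * M" for m
    unfolding C_def x_def by (rule Fejer_sum_bound[OF f M])
  have nh: "real n * h = pi / 2" using n by (simp add: h_def)
  \<comment> \<open>This removes the boundary term with the plain partial sum, for which no uniform
    bound is at hand.\<close>
  have cn: "c n = 0" by (simp add: c_def nh)
  have "real (Suc n) * h = pi / 2 + h" using nh by (simp add: algebra_simps)
  then have cSn: "c (Suc n) = (sin h)\<^sup>2" by (simp add: c_def cos_add)
  have sh: "(sin h)\<^sup>2 \<le> h\<^sup>2"
    using abs_sin_x_le_abs_x[of h] by (simp add: abs_le_square_iff)
  \<comment> \<open>By the double-angle formula \<open>c\<close> is a sampled cosine plus a
    constant, so its second difference is the cosine at the middle point times
    \<open>cos (2 * h) - 1\<close>.\<close>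
  have D: "\<bar>c j - 2 * c (Suc j) + c (Suc (Suc j))\<bar> \<le> 2 * h\<^sup>2" for j
  proof -
    define y where "y = 2 * (real (Suc j) * h)"
    have c: "c i = (1 + cos (2 * (real i * h))) / 2" for i
      by (simp add: c_def cos_double_cos)
    have y: "2 * (real j * h) = y - 2 * h" "2 * (real (Suc (Suc j)) * h) = y + 2 * h"
      by (simp_all add: y_def algebra_simps)
    have "c j - 2 * c (Suc j) + c (Suc (Suc j)) = cos y * (cos (2 * h) - 1)"
      unfolding c y y_def[symmetric] by (simp add: cos_add cos_diff field_simps)
    also have "\<dots> = - (cos y * (2 * (sin h)\<^sup>2))"
      by (simp add: cos_double_sin)
    finally have "\<bar>c j - 2 * c (Suc j) + c (Suc (Suc j))\<bar> = \<bar>cos y\<bar> * (2 * (sin h)\<^sup>2)"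
      by (simp add: abs_mult)
    also have "\<dots> \<le> 1 * (2 * h\<^sup>2)"
      using sh by (intro mult_mono) auto
    finally show ?thesis by simp
  qed
  have "Grunwald_Durrmeyer n f \<theta> = (\<Sum>j<n. c j * x j)"
    unfolding Grunwald_Durrmeyer_eq[OF f] c_def h_def x_def by simp
  also have "\<dots> = (\<Sum>j<n. (c j - 2 * c (Suc j) + c (Suc (Suc j))) * C (Suc j)) - (sin h)\<^sup>2 * C n"
    unfolding summation_by_parts_twice[of c x n] C_def[symmetric] cn cSn by simp
  also have "\<bar>\<dots>\<bar> \<le> (\<Sum>j<n. 2 * h\<^sup>2 * (real n * M)) + h\<^sup>2 * (real n * M)"
  proof (rule order_trans[OF abs_triangle_ineq4], rule add_mono)
    show "\<bar>\<Sum>j<n. (c j - 2 * c (Suc j) + c (Suc (Suc j))) * C (Suc j)\<bar> \<le> (\<Sum>j<n. 2 * h\<^sup>2 * (real n * M))"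
    proof (rule order_trans[OF sum_abs], rule sum_mono)
      fix j assume "j \<in> {..<n}"
      then have "real (Suc j) * M \<le> real n * M" using M0 by (intro mult_right_mono) auto
      then show "\<bar>(c j - 2 * c (Suc j) + c (Suc (Suc j))) * C (Suc j)\<bar> \<le> 2 * h\<^sup>2 * (real n * M)"
        unfolding abs_mult using D[of j] C[of "Suc j"] by (intro mult_mono) linarith+
    qed
    show "\<bar>(sin h)\<^sup>2 * C n\<bar> \<le> h\<^sup>2 * (real n * M)"
      unfolding abs_mult using sh C[of n] by (intro mult_mono) auto
  qed
  also have "\<dots> = h\<^sup>2 * real n * (2 * real n + 1) * M" by (simp add: algebra_simps)
  also have "\<dots> \<le> h\<^sup>2 * real n * (3 * real n) * M"
    using n M0 by (intro mult_right_mono mult_left_mono) auto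
  also have "\<dots> = 3 * (real n * h)\<^sup>2 * M" by (simp add: power2_eq_square)
  also have "\<dots> = 3 * pi\<^sup>2 / 4 * M" unfolding nh by (simp add: power_divide)
  \<comment> \<open>The constant \<open>8\<close> is a round upper bound for
    \<open>3 * pi\<^sup>2 / 4\<close>, obtained from \<open>pi \<le> 3.2\<close>.\<close>
  also have "\<dots> \<le> 8 * M"
  proof (rule mult_right_mono[OF _ M0])
    have "pi\<^sup>2 \<le> (32 / 10)\<^sup>2" using pi_approx by (intro power_mono) auto
    then show "3 * pi\<^sup>2 / 4 \<le> 8" by (simp add: power2_eq_square)
  qed
  finally show ?thesis .
qed

section \<open>Convergence on polynomials in the cosine\<close>

lemma Grunwald_Durrmeyer_add:
  assumes "continuous_on {0..pi} f" "continuous_on {0..pi} g"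
  shows "Grunwald_Durrmeyer n (\<lambda>t. f t + g t) \<theta> = Grunwald_Durrmeyer n f \<theta> + Grunwald_Durrmeyer n g \<theta>"
proof -
  have "integral {0..pi} (\<lambda>t. (f t + g t) * cos (real j * t)) =
    integral {0..pi} (\<lambda>t. f t * cos (real j * t)) + integral {0..pi} (\<lambda>t. g t * cos (real j * t))" for j
    unfolding distrib_right
    by (intro integral_add integrable_continuous_real continuous_intros assms)
  then show ?thesis
    using assms by (simp add: Grunwald_Durrmeyer_eq continuous_on_add sum.distrib[symmetric] field_simps)
qed

lemma Grunwald_Durrmeyer_cmult:
  "Grunwald_Durrmeyer n (\<lambda>t. a * f t) \<theta> = a * Grunwald_Durrmeyer n f \<theta>"
  by (simp add: Grunwald_Durrmeyer_def mult.assoc sum_distrib_left mult.left_commute)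

text \<open>Cosines of degree below \<open>n\<close> are eigenfunctions: continuous orthogonality
  leaves only the term \<open>j = i\<close>.\<close>

lemma Grunwald_Durrmeyer_cos:
  assumes "i < n"
  shows "Grunwald_Durrmeyer n (\<lambda>t. cos (real i * t)) \<theta> =
    (cos (real i * (pi / (2 * real n))))\<^sup>2 * cos (real i * \<theta>)"
proof -
  have "Grunwald_Durrmeyer n (\<lambda>t. cos (real i * t)) \<theta> =
    (\<Sum>j<n. if i = j then (cos (real j * (pi / (2 * real n))))\<^sup>2 * cos (real j * \<theta>) else 0)"
    unfolding Grunwald_Durrmeyer_eq[OF continuous_on_cos[OF continuous_on_mult_left[OF continuous_on_id]]]
      integral_cos_mult_cos
    by (intro sum.cong refl) (simp add: cosw_def)
  then show ?thesis using assms by simp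
qed

text \<open>Continuity is bundled in because additivity of the operator is proved for continuous
  functions; the closure lemmas can then be chained freely.\<close>

definition GD_converges :: "(real \<Rightarrow> real) \<Rightarrow> bool" where
  "GD_converges f \<longleftrightarrow> continuous_on {0..pi} f \<and>
     uniform_limit {0..pi} (\<lambda>n. Grunwald_Durrmeyer n f) f sequentially"

lemma GD_converges_add:
  assumes "GD_converges f" "GD_converges g"
  shows "GD_converges (\<lambda>t. f t + g t)"
proof -
  have "Grunwald_Durrmeyer n (\<lambda>t. f t + g t) = (\<lambda>\<theta>. Grunwald_Durrmeyer n f \<theta> + Grunwald_Durrmeyer n g \<theta>)" for n
    using assms by (auto simp: GD_converges_def Grunwald_Durrmeyer_add)
  then show ?thesis
    using assms by (simp add: GD_converges_def continuous_on_add uniform_limit_add)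
qed

lemma GD_converges_cmult:
  assumes "GD_converges f"
  shows "GD_converges (\<lambda>t. a * f t)"
  using assms unfolding GD_converges_def Grunwald_Durrmeyer_cmult
  by (auto intro!: continuous_intros bounded_linear.uniform_limit[OF bounded_linear_mult_right])

lemma GD_converges_cos: "GD_converges (\<lambda>t. cos (real i * t))"
  unfolding GD_converges_def
proof (intro conjI)
  let ?c = "\<lambda>n. (cos (real i * (pi / (2 * real n))))\<^sup>2"
  have "(\<lambda>n. real i * (pi / (2 * real n))) \<longlonglongrightarrow> 0"
    by real_asymp
  then have "?c \<longlonglongrightarrow> (cos 0)\<^sup>2" by (intro tendsto_intros)
  then have c: "?c \<longlonglongrightarrow> 1" by simp
  show "uniform_limit {0..pi} (\<lambda>n. Grunwald_Durrmeyer n (\<lambda>t. cos (real i * t)))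
     (\<lambda>t. cos (real i * t)) sequentially"
  proof (rule uniform_limitI)
    fix e :: real assume "e > 0"
    \<comment> \<open>The eigenvalue formula requires \<open>i < n\<close>, which holds
      eventually.\<close>
    from tendstoD[OF c this] eventually_gt_at_top[of i]
    show "\<forall>\<^sub>F n in sequentially. \<forall>x\<in>{0..pi}.
      dist (Grunwald_Durrmeyer n (\<lambda>t. cos (real i * t)) x) (cos (real i * x)) < e"
    proof eventually_elim
      case (elim n)
      have "\<bar>?c n * cos (real i * x) - cos (real i * x)\<bar> < e" for x
      proof -
        have "\<bar>?c n * cos (real i * x) - cos (real i * x)\<bar> = \<bar>?c n - 1\<bar> * \<bar>cos (real i * x)\<bar>"
          by (simp add: abs_mult[symmetric] left_diff_distrib)
        also have "\<dots> \<le> \<bar>?c n - 1\<bar>" by (simp add: mult_left_le)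
        finally show ?thesis using elim by (simp add: dist_real_def)
      qed
      then show ?case using elim by (simp add: Grunwald_Durrmeyer_cos dist_real_def)
    qed
  qed
qed (intro continuous_intros)

text \<open>The extra factor \<open>cos (real i * t)\<close> lets the induction on \<open>m\<close>
  absorb one power of \<open>cos t\<close>: the product becomes half the sum of the neighbouring
  frequencies \<open>i - 1\<close> and \<open>i + 1\<close>.\<close>

lemma GD_converges_cos_power: "GD_converges (\<lambda>t. cos t ^ m * cos (real i * t))"
proof (induction m arbitrary: i)
  case 0
  then show ?case using GD_converges_cos by simp
next
  case (Suc m)
  show ?case
  proof (cases i)
    case 0
    then show ?thesis using Suc[of 1] by (simp add: mult.commute)
  next
    case (Suc l)
    have "cos t ^ Suc m * cos (real i * t) =
      1 / 2 * (cos t ^ m * cos (real l * t)) + 1 / 2 * (cos t ^ m * cos (real (Suc i) * t))" for t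
    proof -
      have "cos (real l * t) = cos (real i * t - t)" "cos (real (Suc i) * t) = cos (real i * t + t)"
        by (simp_all add: Suc algebra_simps)
      then show ?thesis by (simp add: cos_add cos_diff algebra_simps)
    qed
    then show ?thesis
      using GD_converges_add[OF GD_converges_cmult[OF Suc.IH[of l], of "1 / 2"] GD_converges_cmult[OF Suc.IH[of "Suc i"], of "1 / 2"]]
      by simp
  qed
qed

lemma GD_converges_cos_poly: "GD_converges (\<lambda>t. \<Sum>i\<le>m. a i * cos t ^ i)"
proof (induction m)
  case 0
  show ?case using GD_converges_cmult[OF GD_converges_cos_power[of 0 0], of "a 0"] by simp
next
  case (Suc m)
  show ?case
    using GD_converges_add[OF Suc GD_converges_cmult[OF GD_converges_cos_power[of "Suc m" 0], of "a (Suc m)"]]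
    by simp
qed

section \<open>Density and passage to continuous functions\<close>

text \<open>The substitution \<open>x = cos t\<close> carries the claim to polynomial approximation
  of \<open>f (arccos x)\<close> on \<open>{-1..1}\<close>.\<close>

lemma cos_poly_dense:
  assumes f: "continuous_on {0..pi} f" and "e > 0"
  obtains m and a :: "nat \<Rightarrow> real"
  where "\<And>t. t \<in> {0..pi} \<Longrightarrow> \<bar>f t - (\<Sum>i\<le>m. a i * cos t ^ i)\<bar> < e"
proof -
  have "continuous_on {-1..1} (\<lambda>x. f (arccos x))"
    by (rule continuous_on_compose2[OF f]) (auto intro!: continuous_intros arccos_lbound arccos_ubound)
  then obtain p where p: "real_polynomial_function p" "\<And>x. x \<in> {-1..1} \<Longrightarrow> \<bar>f (arccos x) - p x\<bar> < e"
    using Stone_Weierstrass_real_polynomial_function[of "{-1..1}" "\<lambda>x. f (arccos x)" e] \<open>e > 0\<close> by auto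
  from p(1) obtain m a where "p = (\<lambda>x. \<Sum>i\<le>m. a i * x ^ i)"
    unfolding real_polynomial_function_iff_sum by blast
  then have "\<bar>f t - (\<Sum>i\<le>m. a i * cos t ^ i)\<bar> < e" if "t \<in> {0..pi}" for t
    using p(2)[of "cos t"] that by (simp add: arccos_cos)
  then show ?thesis using that by blast
qed

text \<open>A uniform bound on the operators together with convergence on a dense class yields
  convergence everywhere, as in Banach--Steinhaus.\<close>

lemma GD_converges_continuous:
  assumes f: "continuous_on {0..pi} f"
  shows "GD_converges f"
  unfolding GD_converges_def
proof (intro conjI f uniform_limitI)
  fix e :: real assume "e > 0"
  \<comment> \<open>The error splits into the operator on \<open>f - g\<close>, the error for
    \<open>g\<close>, and \<open>f - g\<close> itself: \<open>8 / 10 + 1 / 10 + 1 / 10\<close> of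
    \<open>e\<close>.\<close>
  then obtain m a where *: "\<And>t. t \<in> {0..pi} \<Longrightarrow> \<bar>f t - (\<Sum>i\<le>m. a i * cos t ^ i)\<bar> < e / 10"
    using cos_poly_dense[OF f, of "e / 10"] by (metis divide_pos_pos zero_less_numeral)
  define g where "g t = (\<Sum>i\<le>m. a i * cos t ^ i)" for t
  have g: "continuous_on {0..pi} g" "uniform_limit {0..pi} (\<lambda>n. Grunwald_Durrmeyer n g) g sequentially"
    using GD_converges_cos_poly[of a m] unfolding GD_converges_def g_def by auto
  have fg: "\<bar>f t + (-1) * g t\<bar> < e / 10" if "t \<in> {0..pi}" for t
    using *[OF that] by (simp add: g_def)
  have "e / 10 > 0" using \<open>e > 0\<close> by simp
  from uniform_limitD[OF g(2) this] eventually_gt_at_top[of 0]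
  show "\<forall>\<^sub>F n in sequentially. \<forall>x\<in>{0..pi}. dist (Grunwald_Durrmeyer n f x) (f x) < e"
  proof eventually_elim
    case (elim n)
    show ?case
    proof
      fix x assume x: "x \<in> {0..pi}"
      have "\<bar>Grunwald_Durrmeyer n (\<lambda>t. f t + (-1) * g t) x\<bar> \<le> 8 * (e / 10)"
        using fg elim(2) by (intro Grunwald_Durrmeyer_bound continuous_intros f g) (auto intro: less_imp_le)
      moreover have "Grunwald_Durrmeyer n (\<lambda>t. f t + (-1) * g t) x = Grunwald_Durrmeyer n f x - Grunwald_Durrmeyer n g x"
        using g(1) f by (subst Grunwald_Durrmeyer_add) (auto intro!: continuous_intros simp: Grunwald_Durrmeyer_cmult[of n "-1" g, simplified])
      moreover have "\<bar>Grunwald_Durrmeyer n g x - g x\<bar> < e / 10"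
        using elim(1) x by (simp add: dist_real_def)
      ultimately show "dist (Grunwald_Durrmeyer n f x) (f x) < e"
        using fg[OF x] unfolding dist_real_def by linarith
    qed
  qed
qed

theorem theorem3p2:
  fixes f :: "real \<Rightarrow> real"
  assumes "continuous_on {0..pi} f"
  shows "(\<lambda>n. sup_norm (\<lambda>\<theta>. Grunwald_Durrmeyer n f \<theta> - f \<theta>)) \<longlonglongrightarrow> 0"
proof (rule tendstoI)
  fix e :: real assume "e > 0"
  have "uniform_limit {0..pi} (\<lambda>n. Grunwald_Durrmeyer n f) f sequentially"
    using GD_converges_continuous[OF assms] by (simp add: GD_converges_def)
  \<comment> \<open>A supremum inherits only the weak inequality, so \<open>e / 2\<close> restores
    strictness.\<close>
  from uniform_limitD[OF this, of "e / 2"] \<open>e > 0\<close>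
  have "\<forall>\<^sub>F n in sequentially. \<forall>x\<in>{0..pi}. dist (Grunwald_Durrmeyer n f x) (f x) < e / 2"
    by simp
  then show "\<forall>\<^sub>F n in sequentially. dist (sup_norm (\<lambda>\<theta>. Grunwald_Durrmeyer n f \<theta> - f \<theta>)) 0 < e"
  proof eventually_elim
    case (elim n)
    then have le: "\<bar>Grunwald_Durrmeyer n f x - f x\<bar> \<le> e / 2" if "x \<in> {0..pi}" for x
      using that by (auto simp: dist_real_def intro: less_imp_le)
    have "sup_norm (\<lambda>\<theta>. Grunwald_Durrmeyer n f \<theta> - f \<theta>) \<le> e / 2"
      unfolding sup_norm_def using le by (intro cSUP_least) auto
    \<comment> \<open>Any point of the interval shows that the supremum is nonnegative; boundedness
      above comes from \<open>le\<close>.\<close>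
    moreover have "\<bar>Grunwald_Durrmeyer n f 0 - f 0\<bar> \<le> sup_norm (\<lambda>\<theta>. Grunwald_Durrmeyer n f \<theta> - f \<theta>)"
      unfolding sup_norm_def by (rule cSUP_upper, simp, rule bdd_aboveI2, rule le)
    ultimately show ?case using \<open>e > 0\<close> by (simp add: dist_real_def)
  qed
qed

end
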